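(* Let $G=(V,E)$ be a finite, simple, connected graph that is AT-free and contains no bad claw as an induced subgraph, and let $s$ be an admissible vertex of $G$. Then every LBFS order of $G$ starting in $s$ is an AT-free order and a monotone dominating pair order of $G$.
   Context: An asteroidal triple is an independent set of three vertices such that for any two of them there is a path between them containing no neighbour of the third; $G$ is AT-free if it has none. A path $P$ avoids a vertex $v$ if $v$ has no neighbour on $P$. The domination betweenness $\mathcal{B}_D(G)$ is the set of triples $(x,y,z)$ of distinct vertices such that there is a chordless $x$-$y$-path avoiding $z$ and a chordless $y$-$z$-path avoiding $x$. A vertex $y$ is admissible if there are no $x,z$ with $(x,y,z)\in\mathcal{B}_D(G)$. A bad claw is a set of vertices $a,b,z,c$ inducing a claw $K_{1,3}$ with base (centre) $c$ and prongs $a,b,z$ such that $(a,z,b)\in\mathcal{B}_D(G)$. An AT-free order is an ordering $\tau$ of $V$ such that for every $(x,y,z)\in\mathcal{B}_D(G)$ we have $y\prec_\tau x$ or $y\prec_\tau z$. Two vertices $a,b$ form a dominating pair of a graph $H$ if the vertex set of every $a$-$b$-path in $H$ is a dominating set of $H$. An ordering $\tau=(v_1,\ldots,v_n)$ is a monotone dominating pair order if for every $i$ the vertices $v_1,v_i$ form a dominating pair of $G[\{v_1,\ldots,v_i\}]$. Lexicographic BFS (LBFS) from $s$: give $s$ label $n$ and all other vertices the empty label; for $i=1,\ldots,n$ pick an unnumbered vertex $v$ with lexicographically largest label (ties broken arbitrarily; the first pick is $s$), set $\tau(i)=v$, and append $n-i$ to the label of every unnumbered neighbour of $v$. An LBFS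 order starting in $s$ is any ordering so produced. *)

theory Defs
  imports "Graph_Theory.Digraph_Component_Vwalk"
begin

(* Following the library, an undirected finite simple graph is a symmetric digraph
   satisfying the locale predicate graph; u and v are adjacent iff u dominates v
   in the sense of the library. *)

definition path_between :: "('a,'b) pre_digraph \<Rightarrow> 'a \<Rightarrow> 'a list \<Rightarrow> 'a \<Rightarrow> bool" where
  "path_between G u p v \<longleftrightarrow> vpath p G \<and> hd p = u \<and> last p = v"

definition chordless :: "('a,'b) pre_digraph \<Rightarrow> 'a list \<Rightarrow> bool" where
  "chordless G p \<longleftrightarrow> (\<forall>i j. Suc i < j \<and> j < length p \<longrightarrow> \<not> p ! i \<rightarrow>\<^bsub>G\<^esub> p ! j)"

definition avoids :: "('a,'b) pre_digraph \<Rightarrow> 'a list \<Rightarrow> 'a \<Rightarrow> bool" where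
  "avoids G p v \<longleftrightarrow> (\<forall>u \<in> set p. \<not> v \<rightarrow>\<^bsub>G\<^esub> u)"

definition independent_set :: "('a,'b) pre_digraph \<Rightarrow> 'a set \<Rightarrow> bool" where
  "independent_set G A \<longleftrightarrow> A \<subseteq> verts G \<and> (\<forall>u \<in> A. \<forall>v \<in> A. \<not> u \<rightarrow>\<^bsub>G\<^esub> v)"

definition asteroidal_triple :: "('a,'b) pre_digraph \<Rightarrow> 'a set \<Rightarrow> bool" where
  "asteroidal_triple G A \<longleftrightarrow> independent_set G A \<and> card A = 3 \<and>
     (\<forall>u \<in> A. \<forall>v \<in> A. \<forall>w \<in> A. distinct [u, v, w] \<longrightarrow>
        (\<exists>p. path_between G u p v \<and> avoids G p w))"

definition at_free :: "('a,'b) pre_digraph \<Rightarrow> bool" where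
  "at_free G \<longleftrightarrow> (\<nexists>A. asteroidal_triple G A)"

definition domination_betweenness :: "('a,'b) pre_digraph \<Rightarrow> ('a \<times> 'a \<times> 'a) set" where
  "domination_betweenness G =
     {(x, y, z). {x, y, z} \<subseteq> verts G \<and> distinct [x, y, z] \<and>
        (\<exists>p. path_between G x p y \<and> chordless G p \<and> avoids G p z) \<and>
        (\<exists>q. path_between G y q z \<and> chordless G q \<and> avoids G q x)}"

definition admissible :: "('a,'b) pre_digraph \<Rightarrow> 'a \<Rightarrow> bool" where
  "admissible G y \<longleftrightarrow> y \<in> verts G \<and> (\<nexists>x z. (x, y, z) \<in> domination_betweenness G)"

definition induces_claw :: "('a,'b) pre_digraph \<Rightarrow> 'a \<Rightarrow> 'a \<Rightarrow> 'a \<Rightarrow> 'a \<Rightarrow> bool" where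
  "induces_claw G c a b z \<longleftrightarrow> {c, a, b, z} \<subseteq> verts G \<and> distinct [c, a, b, z] \<and>
     c \<rightarrow>\<^bsub>G\<^esub> a \<and> c \<rightarrow>\<^bsub>G\<^esub> b \<and> c \<rightarrow>\<^bsub>G\<^esub> z \<and> independent_set G {a, b, z}"

definition bad_claw :: "('a,'b) pre_digraph \<Rightarrow> 'a \<Rightarrow> 'a \<Rightarrow> 'a \<Rightarrow> 'a \<Rightarrow> bool" where
  "bad_claw G c a b z \<longleftrightarrow> induces_claw G c a b z \<and> (a, z, b) \<in> domination_betweenness G"

definition vertex_ordering :: "('a,'b) pre_digraph \<Rightarrow> 'a list \<Rightarrow> bool" where
  "vertex_ordering G \<tau> \<longleftrightarrow> distinct \<tau> \<and> set \<tau> = verts G"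

definition precedes :: "'a list \<Rightarrow> 'a \<Rightarrow> 'a \<Rightarrow> bool" where
  "precedes \<tau> u v \<longleftrightarrow> (\<exists>i j. i < j \<and> j < length \<tau> \<and> \<tau> ! i = u \<and> \<tau> ! j = v)"

definition at_free_order :: "('a,'b) pre_digraph \<Rightarrow> 'a list \<Rightarrow> bool" where
  "at_free_order G \<tau> \<longleftrightarrow> vertex_ordering G \<tau> \<and>
     (\<forall>(x, y, z) \<in> domination_betweenness G. precedes \<tau> y x \<or> precedes \<tau> y z)"

definition dominating_set :: "('a,'b) pre_digraph \<Rightarrow> 'a set \<Rightarrow> bool" where
  "dominating_set H D \<longleftrightarrow> D \<subseteq> verts H \<and> (\<forall>v \<in> verts H. v \<in> D \<or> (\<exists>u \<in> D. u \<rightarrow>\<^bsub>H\<^esub> v))"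

definition dominating_pair :: "('a,'b) pre_digraph \<Rightarrow> 'a \<Rightarrow> 'a \<Rightarrow> bool" where
  "dominating_pair H a b \<longleftrightarrow> a \<in> verts H \<and> b \<in> verts H \<and>
     (\<forall>p. path_between H a p b \<longrightarrow> dominating_set H (set p))"

definition monotone_dominating_pair_order :: "('a,'b) pre_digraph \<Rightarrow> 'a list \<Rightarrow> bool" where
  "monotone_dominating_pair_order G \<tau> \<longleftrightarrow> vertex_ordering G \<tau> \<and>
     (\<forall>i < length \<tau>. dominating_pair (G \<restriction> set (take (Suc i) \<tau>)) (\<tau> ! 0) (\<tau> ! i))"

(* lbfs_state G s l \<tau>: a run of LBFS from s can reach the labelling l with exactly the
   vertices of \<tau> numbered, in this order. In lexord a proper prefix is smaller.
   The i-th pick has i = Suc (length \<tau>). *)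
inductive lbfs_state :: "('a,'b) pre_digraph \<Rightarrow> 'a \<Rightarrow> ('a \<Rightarrow> nat list) \<Rightarrow> 'a list \<Rightarrow> bool"
  for G :: "('a,'b) pre_digraph" and s :: 'a where
  start: "lbfs_state G s (\<lambda>v. if v = s then [card (verts G)] else []) []"
| pick: "\<lbrakk>lbfs_state G s l \<tau>; v \<in> verts G - set \<tau>;
      \<forall>w \<in> verts G - set \<tau>. (l v, l w) \<notin> lexord less_than\<rbrakk> \<Longrightarrow>
    lbfs_state G s
      (\<lambda>w. if w \<in> verts G - set (\<tau> @ [v]) \<and> v \<rightarrow>\<^bsub>G\<^esub> w
           then l w @ [card (verts G) - Suc (length \<tau>)] else l w)
      (\<tau> @ [v])"

definition lbfs_order :: "('a,'b) pre_digraph \<Rightarrow> 'a \<Rightarrow> 'a list \<Rightarrow> bool" where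
  "lbfs_order G s \<tau> \<longleftrightarrow> (\<exists>l. lbfs_state G s l \<tau>) \<and> length \<tau> = card (verts G)"

lemma lbfs_state_distinct:
  "lbfs_state G s l \<tau> \<Longrightarrow> distinct \<tau> \<and> set \<tau> \<subseteq> verts G"
  by (induction rule: lbfs_state.induct) auto

lemma lbfs_order_vertex_ordering:
  assumes "finite (verts G)" "lbfs_order G s \<tau>"
  shows "vertex_ordering G \<tau>"
  using assms unfolding lbfs_order_def vertex_ordering_def
  by (metis card_subset_eq distinct_card lbfs_state_distinct)

lemma lbfs_state_hd:
  assumes "s \<in> verts G"
  shows "lbfs_state G s l \<tau> \<Longrightarrow> \<tau> \<noteq> [] \<Longrightarrow> hd \<tau> = s"
proof (induction rule: lbfs_state.induct)
  case (pick l \<tau> v)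
  show ?case
  proof (cases "\<tau> = []")
    case True
    with pick.hyps(1) have "l = (\<lambda>v. if v = s then [card (verts G)] else [])"
      by (auto elim: lbfs_state.cases)
    with pick.hyps(3) True assms show ?thesis
      by (auto split: if_splits)
  qed (use pick in auto)
qed simp

end

theory Submission
  imports Defs
begin

text \<open>
  Call \<open>x\<close> and \<open>y\<close> connected off \<open>w\<close> if some path between them avoids \<open>w\<close>. LBFS enters only
  through the four-point property of its orders: if \<open>a < b < c\<close>, \<open>a\<close> is adjacent to \<open>c\<close> but not
  to \<open>b\<close>, then some \<open>d < a\<close> is adjacent to \<open>b\<close> but not to \<open>c\<close>.

  Suppose \<open>(x, y, z)\<close> is a betweenness triple with \<open>x < z < y\<close>. Since \<open>x\<close> and \<open>z\<close> are not
  connected off \<open>y\<close>, comparing BFS parents shows that \<open>y\<close> and \<open>z\<close> have the same parent \<open>u\<close>, and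
  \<open>u\<close> is not adjacent to \<open>x\<close> because there are no bad claws. Let \<open>t\<close> be the parent of \<open>u\<close>.
  Were \<open>y\<close> and \<open>z\<close> connected off \<open>t\<close>, then \<open>u\<close> would be the centre of a bad claw with prongs
  \<open>t, y, z\<close>. Hence \<open>z\<close> lies in a component off \<open>t\<close> that does not contain \<open>y\<close>, and the four-point
  property together with the admissibility of \<open>s\<close> shows that no path from \<open>s\<close> to \<open>y\<close> avoids \<open>z\<close>,
  a contradiction. The same separation argument with \<open>t = s\<close> shows that for \<open>z < y\<close> every
  path from \<open>s\<close> to \<open>y\<close> dominates \<open>z\<close>.
\<close>

section \<open>Connection avoiding the neighbourhood of a vertex\<close>

text \<open>The step relation tests only its target, so the start is tested separately.\<close>

definition avoid_conn :: "('a \<Rightarrow> 'a \<Rightarrow> bool) \<Rightarrow> 'a \<Rightarrow> 'a \<Rightarrow> 'a \<Rightarrow> bool" where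
  "avoid_conn E w x y \<longleftrightarrow> \<not> E w x \<and> (\<lambda>a b. E a b \<and> \<not> E w b)\<^sup>*\<^sup>* x y"

lemma avoid_conn_refl: "\<not> E w x \<Longrightarrow> avoid_conn E w x x"
  by (simp add: avoid_conn_def)

lemma avoid_conn_nonadj_left: "avoid_conn E w x y \<Longrightarrow> \<not> E w x"
  by (simp add: avoid_conn_def)

lemma avoid_conn_nonadj_right:
  assumes "avoid_conn E w x y"
  shows "\<not> E w y"
proof -
  have "(\<lambda>a b. E a b \<and> \<not> E w b)\<^sup>*\<^sup>* x y" "\<not> E w x"
    using assms by (auto simp: avoid_conn_def)
  then show ?thesis by (induction rule: rtranclp_induct) auto
qed

lemma avoid_conn_trans: "avoid_conn E w x y \<Longrightarrow> avoid_conn E w y z \<Longrightarrow> avoid_conn E w x z"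
  unfolding avoid_conn_def by (meson rtranclp_trans)

lemma avoid_conn_step: "avoid_conn E w x y \<Longrightarrow> E y z \<Longrightarrow> \<not> E w z \<Longrightarrow> avoid_conn E w x z"
  unfolding avoid_conn_def by (auto intro: rtranclp.rtrancl_into_rtrancl)

lemma avoid_conn_induct [consumes 1, case_names base step]:
  assumes "avoid_conn E w x y"
    and "\<not> E w x \<Longrightarrow> P x"
    and "\<And>a b. avoid_conn E w x a \<Longrightarrow> P a \<Longrightarrow> E a b \<Longrightarrow> \<not> E w b \<Longrightarrow> P b"
  shows "P y"
proof -
  have nx: "\<not> E w x" and "(\<lambda>a b. E a b \<and> \<not> E w b)\<^sup>*\<^sup>* x y"
    using assms(1) by (auto simp: avoid_conn_def)
  from this(2) show ?thesis
  proof (induction rule: rtranclp_induct)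
    case base
    from nx show ?case by (rule assms(2))
  next
    case (step a b)
    then show ?case using nx by (intro assms(3)[of a b]) (auto simp: avoid_conn_def)
  qed
qed

lemma avoid_conn_sym:
  assumes sym: "symp E" and "avoid_conn E w x y"
  shows "avoid_conn E w y x"
  using assms(2)
proof (induction rule: avoid_conn_induct)
  case base
  then show ?case by (rule avoid_conn_refl)
next
  case (step a b)
  have "avoid_conn E w b a"
    using step by (intro avoid_conn_step[OF avoid_conn_refl])
      (auto intro: sympD[OF sym] dest: avoid_conn_nonadj_right)
  then show ?case using step.IH by (rule avoid_conn_trans)
qed

section \<open>Vertex orders with the LBFS four-point property\<close>

text \<open>\<open>rk\<close> stands for the position in the order.\<close>

locale lbfs_ranked_graph =
  fixes V :: "'a set" and E :: "'a \<Rightarrow> 'a \<Rightarrow> bool" and s :: 'a and rk :: "'a \<Rightarrow> nat"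
  assumes sym: "E a b \<Longrightarrow> E b a"
    and irrefl: "\<not> E a a"
    and adj_in_V: "E a b \<Longrightarrow> a \<in> V"
    and rk_inj: "inj_on rk V"
    and s_in_V: "s \<in> V"
    and s_first: "v \<in> V \<Longrightarrow> rk s \<le> rk v"
    and connected_from_s: "v \<in> V \<Longrightarrow> E\<^sup>*\<^sup>* s v"
    and four_point: "\<lbrakk>rk a < rk b; rk b < rk c; E a c; \<not> E a b; b \<in> V\<rbrakk> \<Longrightarrow>
      \<exists>d. rk d < rk a \<and> E d b \<and> \<not> E d c"
begin

abbreviation conn where "conn \<equiv> avoid_conn E"

lemma conn_sym: "conn w x y \<Longrightarrow> conn w y x"
  by (rule avoid_conn_sym) (auto intro: sympI sym)

lemma conn_in_V:
  assumes "conn w x y" "x \<in> V" shows "y \<in> V"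
  using assms(1)
proof (induction rule: avoid_conn_induct)
  case base
  then show ?case using assms(2) by simp
next
  case (step a b)
  then show ?case using sym adj_in_V by blast
qed

lemma rk_cases:
  assumes "a \<in> V" "b \<in> V" "a \<noteq> b"
  obtains "rk a < rk b" | "rk b < rk a"
  using assms rk_inj by (metis inj_onD linorder_neqE_nat)

definition betw where
  "betw x y z \<longleftrightarrow> {x, y, z} \<subseteq> V \<and> distinct [x, y, z] \<and> conn z x y \<and> conn x y z"

lemma betw_sym: "betw x y z \<Longrightarrow> betw z y x"
  unfolding betw_def by (auto intro: conn_sym)

section \<open>BFS parents\<close>

text \<open>The first neighbour in the order. It is the BFS parent only for
  \<open>v \<noteq> s\<close>, as all neighbours of \<open>s\<close> come after
  \<open>s\<close>.\<close>

definition par where "par v = arg_min rk (E v)"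

text \<open>By connectivity some edge leads from an \<open>a\<close> before \<open>v\<close> to a
  \<open>c\<close> not before \<open>v\<close>. If \<open>a\<close> is not adjacent to
  \<open>v\<close>, the four-point property for \<open>a\<close>, \<open>v\<close>, \<open>c\<close>
  gives a neighbour of \<open>v\<close> before \<open>a\<close>.\<close>

lemma ex_earlier_neighbour:
  assumes "v \<in> V" "v \<noteq> s"
  shows "\<exists>d. E d v \<and> rk d < rk v"
proof -
  have sv: "rk s < rk v" using assms s_first s_in_V by (metis rk_cases leD)
  have "\<exists>a c. E a c \<and> rk a < rk v \<and> \<not> rk c < rk v"
  proof (rule ccontr)
    assume *: "\<nexists>a c. E a c \<and> rk a < rk v \<and> \<not> rk c < rk v"
    have "rk w < rk v" if "E\<^sup>*\<^sup>* s w" for w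
      using that
    proof (induction rule: rtranclp_induct)
      case base
      show ?case using sv .
    next
      case (step a b)
      then show ?case using * by blast
    qed
    then show False using connected_from_s[OF assms(1)] by blast
  qed
  then obtain a c where ac: "E a c" "rk a < rk v" "\<not> rk c < rk v" by blast
  show ?thesis
  proof (cases "E a v")
    case True
    then show ?thesis using ac by blast
  next
    case False
    then have "c \<noteq> v" using ac by auto
    moreover have "c \<in> V" using ac(1) sym adj_in_V by blast
    ultimately have "rk v < rk c" using assms(1) ac(3) by (metis rk_cases)
    then obtain d where "rk d < rk a" "E d v" using four_point ac False assms by blast
    then show ?thesis using ac(2) by (meson less_trans)
  qed
qed

lemma par_first: "E v e \<Longrightarrow> rk (par v) \<le> rk e"
  unfolding par_def by (rule arg_min_nat_le)

lemma par_adj: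
  assumes "v \<in> V" "v \<noteq> s"
  shows "E v (par v)" "E (par v) v" "par v \<in> V" "rk (par v) < rk v"
proof -
  obtain d where d: "E d v" "rk d < rk v" using ex_earlier_neighbour[OF assms] by blast
  then show *: "E v (par v)" unfolding par_def by (intro arg_min_natI) (auto intro: sym)
  then show "E (par v) v" "par v \<in> V" using sym adj_in_V by blast+
  show "rk (par v) < rk v" using par_first[of v d] d sym by fastforce
qed

text \<open>If \<open>par y\<close> preceded \<open>par x\<close>, it would not be adjacent to
  \<open>x\<close>, and the four-point property for \<open>par y\<close>, \<open>x\<close>,
  \<open>y\<close> would give \<open>x\<close> a neighbour before \<open>par y\<close>.\<close>

lemma par_mono:
  assumes "x \<in> V" "x \<noteq> s" "y \<in> V" "rk x < rk y"
  shows "rk (par x) \<le> rk (par y)"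
proof (rule ccontr)
  assume neg: "\<not> ?thesis"
  have ys: "y \<noteq> s" using assms s_first by fastforce
  have "\<not> E (par y) x" using par_first[of x "par y"] neg sym by force
  moreover have "rk (par y) < rk x" using neg par_adj(4)[of x] assms by linarith
  ultimately obtain d where "rk d < rk (par y)" "E d x"
    using four_point[of "par y" x y] assms par_adj(2)[of y] ys by blast
  then show False using par_first[of x d] neg sym by fastforce
qed

text \<open>The path from \<open>d\<close> to the root through iterated parents stays off the neighbourhood of \<open>w\<close>,
  because all proper ancestors of \<open>d\<close> precede the first neighbour of \<open>w\<close>.\<close>

lemma conn_root:
  assumes "d \<in> V" "\<not> E w d" "d = s \<or> rk (par d) < rk (par w)"
  shows "conn w s d"
  using assms
proof (induction "rk d" arbitrary: d rule: less_induct)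
  case less
  show ?case
  proof (cases "d = s")
    case True
    then show ?thesis using less avoid_conn_refl by metis
  next
    case False
    note p = par_adj[OF less.prems(1) False]
    have lt: "rk (par d) < rk (par w)" using less.prems False by blast
    have "conn w s (par d)"
    proof (rule less.hyps)
      show "\<not> E w (par d)" using par_first lt leD by blast
      show "par d = s \<or> rk (par (par d)) < rk (par w)" using par_adj(4)[OF p(3)] lt by force
    qed (use p in auto)
    then show ?thesis using p(2) less.prems(2) by (rule avoid_conn_step)
  qed
qed

text \<open>Let \<open>C\<close> be the component of \<open>z\<close> outside the neighbourhood of \<open>t\<close>, and \<open>c\<close> its first vertex.
  The vertices of \<open>M\<close> adjacent to \<open>C\<close> are all adjacent to \<open>z\<close>, and by admissibility of \<open>s\<close>
  to every vertex outside \<open>M\<close> that is reached from \<open>s\<close> by a path avoiding \<open>z\<close>. With the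
  four-point property such a path can neither enter \<open>C\<close> nor get past \<open>c\<close> in the order, so it
  never reaches \<open>y\<close>.\<close>

lemma separation_contradiction:
  assumes V: "y \<in> V" "z \<in> V" and zy: "rk z < rk y"
    and sy: "conn z s y" and sz: "\<not> conn y s z" and tyz: "\<not> conn t y z"
    and adm: "\<And>a b. \<not> betw a s b"
    and M: "M \<subseteq> V" "s \<in> M" "y \<notin> M" "z \<notin> M"
    and down: "\<And>d e. d \<in> M \<Longrightarrow> e \<in> V \<Longrightarrow> rk e < rk d \<Longrightarrow> e \<in> M"
    and root: "\<And>d n. d \<in> M \<Longrightarrow> n \<in> V \<Longrightarrow> n \<notin> M \<Longrightarrow> \<not> E n d \<Longrightarrow> conn n s d"
    and tM: "\<And>n. E t n \<Longrightarrow> n \<in> M"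
  shows False
proof -
  define C where "C = {c. conn t z c}"
  have tz: "\<not> E t z" and ty: "\<not> E t y" using tM M by blast+
  have zC: "z \<in> C" unfolding C_def using tz avoid_conn_refl by force
  have CV: "c \<in> V" if "c \<in> C" for c using that conn_in_V V unfolding C_def by blast
  have yC: "y \<notin> C" using tyz conn_sym unfolding C_def by blast
  have Cy: "\<not> E y c" if "c \<in> C" for c
  proof
    assume "E y c"
    then have "y \<in> C" using that sym avoid_conn_step ty unfolding C_def by (metis mem_Collect_eq)
    then show False using yC by simp
  qed
  have Cz: "conn y c z" if "c \<in> C" for c
  proof -
    have "conn t z c" using that by (simp add: C_def)
    then have "c \<in> C \<and> conn y z c"
    proof (induction rule: avoid_conn_induct)
      case base
      then show ?case using zC Cy avoid_conn_refl by metis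
    next
      case (step a b)
      then have "b \<in> C" unfolding C_def using avoid_conn_step by (metis mem_Collect_eq)
      then show ?case using step Cy avoid_conn_step by metis
    qed
    then show ?thesis using conn_sym by blast
  qed
  have CM: "c \<notin> M" if "c \<in> C" for c
    using that root[of c y] Cy[OF that] Cz[OF that] sz V M avoid_conn_trans by metis
  have NCy: "E y e" if "c \<in> C" "e \<in> M" "E e c" for c e
  proof (rule ccontr)
    assume "\<not> E y e"
    then have "conn y s e" using root V M that by blast
    then have "conn y s c" using that(3) Cy[OF that(1)] by (rule avoid_conn_step)
    then show False using Cz[OF that(1)] sz avoid_conn_trans by metis
  qed
  \<comment> \<open>Otherwise the four-point property for \<open>e\<close>, \<open>z\<close>,
    \<open>y\<close> yields a \<open>d\<close> in \<open>M\<close> adjacent to \<open>z\<close> but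
    not to \<open>y\<close>, against \<open>NCy\<close>.\<close>
  have Uz: "E z e" if eM: "e \<in> M" and ye: "E y e" for e
  proof (rule ccontr)
    assume ne: "\<not> E z e"
    have eV: "e \<in> V" using eM M by blast
    have "rk e < rk z"
      using rk_cases[OF eV V(2)] down[OF eM V(2)] eM M by blast
    then obtain d where d: "rk d < rk e" "E d z" "\<not> E d y"
      using four_point[of e z y] zy ye ne sym V by blast
    then have "d \<in> M" using down[OF eM] adj_in_V by blast
    then show False using NCy[OF zC] d sym by blast
  qed
  have NCz: "E z e" if "c \<in> C" "e \<in> M" "E e c" for c e
    using NCy[OF that] Uz[OF that(2)] by blast
  have zs: "z \<noteq> s" using M by blast
  \<comment> \<open>Otherwise a path through \<open>e\<close> joins \<open>s\<close> to
    \<open>z\<close> off \<open>v\<close>, which places \<open>s\<close> between \<open>v\<close>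
    and \<open>z\<close>.\<close>
  have U_reached: "E e v" if "conn z s v" "v \<notin> M" "e \<in> M" "E z e" for e v
  proof (rule ccontr)
    assume ne: "\<not> E e v"
    have vV: "v \<in> V" using conn_in_V[OF that(1) s_in_V] .
    have nz: "\<not> E z v" using that(1) by (rule avoid_conn_nonadj_right)
    have "conn v s e" using root[OF that(3) vV that(2)] ne sym by blast
    then have "conn v s z" using that(4) nz sym avoid_conn_step by metis
    moreover have "v \<noteq> s" using that(2) M by blast
    \<comment> \<open>\<open>conn z\<close> does not forbid \<open>z\<close> itself, but a path
      starting elsewhere could enter \<open>z\<close> only from a neighbour of
      \<open>z\<close>.\<close>
    moreover have "v \<noteq> z"
    proof
      assume vz: "v = z"
      from that(1) have "v \<noteq> z"
      proof (induction rule: avoid_conn_induct)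
        case base
        then show ?case using zs by simp
      next
        case (step a b)
        then show ?case using avoid_conn_nonadj_right sym by metis
      qed
      with vz show False by simp
    qed
    ultimately have "betw v s z"
      unfolding betw_def using that(1) vV V s_in_V conn_sym zs by auto
    then show False using adm by blast
  qed
  define c where "c = arg_min rk (\<lambda>c. c \<in> C)"
  have cC: "c \<in> C" and cmin: "\<And>d. d \<in> C \<Longrightarrow> rk c \<le> rk d"
    unfolding c_def using zC by (auto intro: arg_min_natI arg_min_nat_le)
  have Ct: "E t a" if "b \<in> C" "E a b" "a \<notin> C" for a b
    using that avoid_conn_step[of E t z b a] sym unfolding C_def by blast
  have Mc: "rk e < rk c" if "e \<in> M" for e
    using that down[OF that CV[OF cC]] CM[OF cC] M rk_cases[OF _ CV[OF cC], of e] by blast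
  have C_sep: "\<not> E a b" if "b \<in> C" "a \<notin> C" "\<not> E z a" for a b
    using that NCz[of b a] Ct[of b a] tM by blast
  from sy have "y \<notin> C \<and> rk y < rk c"
  proof (induction rule: avoid_conn_induct)
    case base
    then show ?case using M CM Mc by blast
  next
    case (step a b)
    have za: "\<not> E z a" using step(1) by (rule avoid_conn_nonadj_right)
    have bC: "b \<notin> C" using C_sep za step by blast
    have zb: "conn z s b" using step.hyps by (rule avoid_conn_step)
    have bV: "b \<in> V" using conn_in_V[OF zb s_in_V] .
    have "rk b < rk c"
    proof (rule ccontr)
      assume neg: "\<not> ?thesis"
      then have bM: "b \<notin> M" using Mc by blast
      have "rk c < rk b" using neg bV CV[OF cC] bC cC by (metis rk_cases)
      moreover have "\<not> E a c" using C_sep[OF cC] step za by blast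
      \<comment> \<open>\<open>d\<close> precedes \<open>c\<close>, so it is outside
        \<open>C\<close>; being adjacent to \<open>c\<close>, it lies in \<open>M\<close> and is
        adjacent to \<open>z\<close>, hence by \<open>U_reached\<close> to \<open>b\<close>.\<close>
      ultimately obtain d where d: "rk d < rk a" "E d c" "\<not> E d b"
        using four_point[of a c b] step CV[OF cC] by blast
      have "d \<notin> C" using cmin d step by fastforce
      then have "d \<in> M" using Ct[OF cC d(2)] tM by blast
      then show False using U_reached[OF zb bM, of d] NCz[OF cC _ d(2)] d(3) by blast
    qed
    then show ?case using bC by simp
  qed
  then show False using cmin[OF zC] zy by linarith
qed

section \<open>Order of the vertices in a betweenness triple\<close>

text \<open>Together with \<open>betw_sym\<close> this excludes every triple whose middle vertex
  comes last.\<close>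

lemma no_late_betw:
  assumes betw: "betw x y z" and xz: "rk x < rk z" and zy: "rk z < rk y"
    and at: "\<And>x y z. betw x y z \<Longrightarrow> \<not> conn y x z"
    and claw: "\<And>c a b z. betw a z b \<Longrightarrow> E c a \<Longrightarrow> E c b \<Longrightarrow> E c z \<Longrightarrow> False"
    and adm: "\<And>a b. \<not> betw a s b"
  shows False
proof -
  have V: "x \<in> V" "y \<in> V" "z \<in> V" and zxy: "conn z x y" and xyz: "conn x y z"
    using betw unfolding betw_def by auto
  have nonadj: "\<not> E y x" "\<not> E z x" "\<not> E z y"
    using avoid_conn_nonadj_left[OF zxy] avoid_conn_nonadj_right[OF zxy]
      avoid_conn_nonadj_left[OF xyz] sym by blast+
  have zs: "z \<noteq> s" and ys: "y \<noteq> s" using xz zy s_first V by fastforce+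
  define u where "u = par y"
  have u: "E y u" "E u y" "u \<in> V" "rk u < rk y" unfolding u_def using par_adj[OF V(2) ys] by auto
  have pz: "rk (par z) \<le> rk u" unfolding u_def using par_mono V zs zy by blast
  have px: "rk (par x) \<le> rk (par z)" if "x \<noteq> s" using par_mono V that xz by blast
  have pzV: "par z \<in> V" "E (par z) z" using par_adj V zs by auto
  have eq: "a = b" if "a \<in> V" "b \<in> V" "rk a = rk b" for a b using that rk_inj by (meson inj_onD)
  \<comment> \<open>For \<open>x \<noteq> s\<close> the parents of \<open>x\<close>,
    \<open>z\<close>, \<open>y\<close> come in this weak order. If all three coincided,
    \<open>u\<close> would be the centre of a bad claw.\<close>
  have x_early: "x = s \<or> rk (par x) < rk u"
  proof (rule ccontr)
    assume neg: "\<not> ?thesis"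
    then have "rk (par x) = rk u" "rk (par z) = rk u" using px pz by auto
    then have "par x = u" "par z = u"
      using u(3) pzV(1) par_adj(3)[OF V(1)] neg by (auto intro: eq)
    then show False using claw[OF betw, of u] u pzV(2) par_adj(2)[OF V(1)] neg by auto
  qed
  have ysx: "conn y s x" using conn_root[OF V(1) nonadj(1)] x_early u_def by simp
  have sz: "\<not> conn y s z"
    using at[OF betw] avoid_conn_trans[OF conn_sym[OF ysx]] by blast
  have zu: "par z = u"
  proof (rule ccontr)
    assume "par z \<noteq> u"
    then have "rk (par z) < rk u" using pz eq pzV(1) u(3) by (metis le_neq_implies_less)
    then show False using conn_root[OF V(3), of y] nonadj(3) sz u_def sym by blast
  qed
  have zsx: "conn z s x" using conn_root[OF V(1) nonadj(2)] x_early zu by simp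
  have sy: "conn z s y" using avoid_conn_trans[OF zsx zxy] .
  have us: "u \<noteq> s" using avoid_conn_nonadj_left[OF ysx] u by blast
  define t where "t = par u"
  have t: "E u t" "t \<in> V" "rk t < rk u" unfolding t_def using par_adj[OF u(3) us] by auto
  have nt: "\<not> E y t" "\<not> E z t"
    using par_first[of y t] par_first[of z t] t(3) u_def zu by fastforce+
  have tz: "conn z t y"
  proof -
    have "t = s \<or> rk (par t) < rk (par z)" using par_adj(4)[OF t(2)] t(3) zu by force
    from conn_root[OF t(2) nt(2) this] show ?thesis using conn_sym sy avoid_conn_trans by metis
  qed
  have tyz: "\<not> conn t y z"
  proof
    assume *: "conn t y z"
    have "t \<noteq> y" "t \<noteq> z" "y \<noteq> z"
      using t(3) u(4) zy zu par_adj(4)[OF V(3) zs] by auto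
    then have "betw t y z" unfolding betw_def using * tz V t by auto
    then show False using claw[of t y z u] t(1) u(2) pzV(2) zu by blast
  qed
  \<comment> \<open>The root and the vertices whose parent precedes \<open>u\<close>: an initial
    segment by \<open>par_mono\<close>. It contains every neighbour of \<open>t\<close>, whose
    parent is no later than \<open>t\<close>.\<close>
  let ?M = "{d \<in> V. d = s \<or> rk (par d) < rk u}"
  show False
  proof (rule separation_contradiction[OF V(2,3) zy sy sz tyz adm, where M = ?M])
    fix d e assume d: "d \<in> ?M" and e: "e \<in> V" "rk e < rk d"
    show "e \<in> ?M"
    proof (cases "e = s")
      case False
      have "d \<noteq> s" using e s_first by fastforce
      then show ?thesis using d e par_mono[OF e(1) False, of d] by auto
    qed (use e in simp)
  next
    fix d n assume "d \<in> ?M" "n \<in> V" "n \<notin> ?M" "\<not> E n d"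
    then show "conn n s d" by (intro conn_root) auto
  next
    fix n assume n: "E t n"
    then show "n \<in> ?M" using par_first[of n t] sym adj_in_V t(3) by fastforce
  qed (use s_in_V u_def zu ys zs in auto)
qed

section \<open>Domination by paths from the root\<close>

lemma root_neighbours_first:
  assumes "E s a" "b \<in> V" "\<not> E s b" "b \<noteq> s"
  shows "rk a < rk b"
proof (rule ccontr)
  assume neg: "\<not> ?thesis"
  have "a \<in> V" using assms(1) sym adj_in_V by blast
  then have "rk b < rk a" using neg assms by (metis rk_cases)
  moreover have "rk s < rk b" using s_first[OF assms(2)] assms s_in_V by (metis rk_cases not_le)
  ultimately obtain d where "rk d < rk s" "E d b" using four_point assms by blast
  then show False using s_first adj_in_V by (meson leD)
qed

text \<open>A path from \<open>s\<close> to \<open>y\<close> that fails to dominate an earlier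
  \<open>z\<close> would give \<open>conn z s y\<close>.\<close>

lemma later_not_conn_root:
  assumes V: "y \<in> V" "z \<in> V" and zy: "rk z < rk y" and sy: "conn z s y" and zs: "z \<noteq> s"
    and late: "\<And>x y z. betw x y z \<Longrightarrow> rk x < rk y \<Longrightarrow> rk z < rk y \<Longrightarrow> False"
    and adm: "\<And>a b. \<not> betw a s b"
  shows False
proof -
  have sz: "\<not> E s z" using avoid_conn_nonadj_left[OF sy] sym by blast
  have ys: "y \<noteq> s" using s_first[OF V(2)] zy by fastforce
  have rs: "rk s < rk y" using zy s_first[OF V(2)] by linarith
  have nsz: "\<not> conn y s z"
  proof
    assume "conn y s z"
    then have "betw y s z" unfolding betw_def using V s_in_V sy conn_sym zs ys zy by auto
    then show False using adm by blast
  qed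
  have nyz: "\<not> conn s y z"
  proof
    assume "conn s y z"
    then have "betw s y z" unfolding betw_def using V s_in_V sy zs ys zy by auto
    then show False using late zy rs by blast
  qed
  have sy': "\<not> E s y" using root_neighbours_first[OF _ V(2) sz zs, of y] zy by auto
  \<comment> \<open>An initial segment by \<open>root_neighbours_first\<close>; \<open>s\<close>
    itself plays the part of \<open>t\<close>.\<close>
  let ?M = "insert s {d. E s d}"
  show False
  proof (rule separation_contradiction[OF V zy sy nsz nyz adm, where M = ?M])
    fix d e assume "d \<in> ?M" "e \<in> V" "rk e < rk d"
    then show "e \<in> ?M" using root_neighbours_first[of d e] s_first[of e] by fastforce
  next
    fix d n assume "d \<in> ?M" "n \<in> V" "n \<notin> ?M" "\<not> E n d"
    then show "conn n s d" using sym avoid_conn_refl[of E n s] avoid_conn_step[of E n s s d] by blast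
  qed (use s_in_V sym adj_in_V sz sy' zs ys in blast)+
qed

end

section \<open>LBFS orders have the four-point property\<close>

text \<open>Positions count from 0, so the pick at position \<open>i\<close> appends
  \<open>card (verts G) - Suc i\<close>.\<close>

lemma lbfs_state_label:
  assumes "lbfs_state G s l \<tau>" "w \<in> verts G - set \<tau>"
  shows "l w = (if w = s then [card (verts G)] else []) @
    map (\<lambda>i. card (verts G) - Suc i) (filter (\<lambda>i. \<tau> ! i \<rightarrow>\<^bsub>G\<^esub> w) [0..<length \<tau>])"
  using assms
proof (induction arbitrary: w rule: lbfs_state.induct)
  case (pick l \<tau> v)
  have "filter (\<lambda>i. (\<tau> @ [v]) ! i \<rightarrow>\<^bsub>G\<^esub> w) [0..<length \<tau>] = filter (\<lambda>i. \<tau> ! i \<rightarrow>\<^bsub>G\<^esub> w) [0..<length \<tau>]"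
    by (rule filter_cong) (auto simp: nth_append)
  then show ?case using pick by (auto simp: nth_append)
qed simp

lemma filter_upt_split:
  assumes "i < m"
  shows "filter P [0..<m] = filter P [0..<i] @ filter P [i] @ filter P [Suc i..<m]"
  by (metis assms filter_append append_Cons append_Nil less_imp_le_nat upt_add_eq_append
      upt_conv_Cons le_add_diff_inverse add_0 zero_le)

text \<open>The labels share the entries from before \<open>i\<close>. Then \<open>Q\<close>
  contributes \<open>n - Suc i\<close>, while the label of \<open>P\<close> ends or continues with
  the smaller entry of a later position; \<open>m \<le> n\<close> keeps the truncated subtraction
  strict.\<close>

lemma filter_label_less:
  assumes "i < m" "m \<le> n" "Q i" "\<not> P i" "\<And>d. d < i \<Longrightarrow> P d \<longleftrightarrow> Q d"
  shows "(map (\<lambda>i. n - Suc i) (filter P [0..<m]), map (\<lambda>i. n - Suc i) (filter Q [0..<m]))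
    \<in> lexord less_than"
proof -
  define g where "g = (\<lambda>i. n - Suc i)"
  define ps where "ps = map g (filter P [Suc i..<m])"
  have eq: "filter P [0..<i] = filter Q [0..<i]"
    using assms(5) by (intro filter_cong) auto
  have P: "map g (filter P [0..<m]) = map g (filter Q [0..<i]) @ ps"
    using assms filter_upt_split[of i m P] eq by (simp add: ps_def)
  have Q: "map g (filter Q [0..<m]) = map g (filter Q [0..<i]) @ g i # map g (filter Q [Suc i..<m])"
    using assms filter_upt_split[of i m Q] by simp
  have "(ps, g i # map g (filter Q [Suc i..<m])) \<in> lexord less_than"
  proof (cases ps)
    case (Cons k ks)
    then have "k \<in> set ps" by simp
    then have "k < g i" using assms unfolding ps_def g_def by auto
    then show ?thesis using Cons by simp
  qed simp
  then show ?thesis unfolding g_def[symmetric] P Q by (rule lexord_append_leftI)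
qed

text \<open>Only the newest pick \<open>v\<close>, at position \<open>j\<close>, needs an argument.
  At that moment \<open>c\<close> is unnumbered too, so the two labels can be compared.\<close>

lemma lbfs_state_four_point:
  assumes "lbfs_state G s l \<tau>" "s \<in> verts G" "finite (verts G)"
    and "i < j" "j < length \<tau>" "c \<in> verts G - set (take (Suc j) \<tau>)"
    and "\<tau> ! i \<rightarrow>\<^bsub>G\<^esub> c" "\<not> \<tau> ! i \<rightarrow>\<^bsub>G\<^esub> \<tau> ! j"
  shows "\<exists>d < i. \<tau> ! d \<rightarrow>\<^bsub>G\<^esub> \<tau> ! j \<and> \<not> \<tau> ! d \<rightarrow>\<^bsub>G\<^esub> c"
  using assms
proof (induction rule: lbfs_state.induct)
  case (pick l \<tau> v)
  show ?case
  proof (cases "j < length \<tau>")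
    case True
    then show ?thesis using pick by (auto simp: nth_append)
  next
    case False
    then have j: "j = length \<tau>" using pick.prems by simp
    have c: "c \<in> verts G - set \<tau>" using pick.prems(5) j by auto
    have ne: "\<tau> \<noteq> []" using pick.prems(3) j by auto
    \<comment> \<open>With \<open>s\<close> already numbered, its initial label concerns neither
      \<open>v\<close> nor \<open>c\<close>.\<close>
    then have "s \<in> set \<tau>" using lbfs_state_hd[OF pick.prems(1) pick.hyps(1) ne] by (metis hd_in_set)
    then have vs: "v \<noteq> s" "c \<noteq> s" using c pick.hyps(2) by auto
    define P Q where "P = (\<lambda>i. \<tau> ! i \<rightarrow>\<^bsub>G\<^esub> v)" and "Q = (\<lambda>i. \<tau> ! i \<rightarrow>\<^bsub>G\<^esub> c)"
    have le: "length \<tau> \<le> card (verts G)"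
      using lbfs_state_distinct[OF pick.hyps(1)] pick.prems(2) by (metis card_mono distinct_card)
    have i: "Q i" "\<not> P i" "i < length \<tau>"
      using pick.prems j unfolding P_def Q_def by (auto simp: nth_append)
    have "\<exists>d < i. P d \<and> \<not> Q d"
    proof (rule ccontr)
      assume neg: "\<not> ?thesis"
      \<comment> \<open>The first position whose vertex is adjacent to \<open>c\<close> but not to
        \<open>v\<close>. Without a suitable \<open>d\<close> the labels agree before it, so
        \<open>c\<close> has the larger one.\<close>
      define k where "k = (LEAST k. Q k \<and> \<not> P k)"
      have k: "Q k" "\<not> P k" unfolding k_def using i LeastI[of "\<lambda>k. Q k \<and> \<not> P k" i] by blast+
      have ki: "k \<le> i" unfolding k_def using i by (intro Least_le) simp
      have "P d \<longleftrightarrow> Q d" if "d < k" for d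
        using neg that ki not_less_Least[of d "\<lambda>k. Q k \<and> \<not> P k"] unfolding k_def[symmetric] by force
      then have "(l v, l c) \<in> lexord less_than"
        using filter_label_less[of k "length \<tau>" "card (verts G)" Q P] k ki i le
          lbfs_state_label[OF pick.hyps(1)] c pick.hyps(2) vs
        unfolding P_def Q_def by simp
      then show False using pick.hyps(3) c by blast
    qed
    then obtain d where d: "d < i" "P d" "\<not> Q d" by blast
    then have "(\<tau> @ [v]) ! d = \<tau> ! d" "(\<tau> @ [v]) ! j = v" using i j by (simp_all add: nth_append)
    then show ?thesis using d unfolding P_def Q_def by (intro exI[of _ d]) simp
  qed
qed simp

section \<open>Paths and connection\<close>

lemma vwalk_arcs_conv_nth:
  "set (vwalk_arcs p) = {(p ! i, p ! Suc i) | i. Suc i < length p}"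
proof (induction p rule: vwalk_arcs.induct)
  case (3 x y xs)
  have "{(p ! i, p ! Suc i) | i. Suc i < length p} =
      insert (p ! 0, p ! 1) {(tl p ! i, tl p ! Suc i) | i. Suc i < length (tl p)}"
    if "p = x # y # xs" for p
  proof -
    have "(\<exists>i. P i \<and> Suc i < length p) \<longleftrightarrow> P 0 \<or> (\<exists>i. P (Suc i) \<and> Suc i < length (tl p))" for P
      using that by (auto simp: gr0_conv_Suc) (metis not0_implies_Suc Suc_less_eq)
    from this[of "\<lambda>i. _ = (p ! i, p ! Suc i)"] show ?thesis using that by auto
  qed
  from this[OF refl] show ?case using 3 by simp
qed auto

lemma path_avoids_imp_avoid_conn:
  assumes "path_between G x p y" "avoids G p w"
  shows "avoid_conn (dominates G) w x y"
proof -
  have p: "p \<noteq> []" "hd p = x" "last p = y" "set (vwalk_arcs p) \<subseteq> arcs_ends G"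
    using assms by (auto simp: path_between_def vpath_def vwalk_def)
  have "avoid_conn (dominates G) w x (p ! i)" if "i < length p" for i
    using that
  proof (induction i)
    case 0
    then show ?case using p assms(2) by (auto simp: hd_conv_nth avoids_def intro!: avoid_conn_refl)
  next
    case (Suc i)
    have "p ! i \<rightarrow>\<^bsub>G\<^esub> p ! Suc i" using p(4) Suc.prems unfolding vwalk_arcs_conv_nth by blast
    then show ?case using Suc assms(2) by (auto simp: avoids_def intro: avoid_conn_step)
  qed
  then show ?thesis using p by (metis last_conv_nth diff_less length_greater_0_conv zero_less_one)
qed

text \<open>A shortest walk off the neighbourhood of \<open>w\<close> is a chordless path.\<close>

lemma avoid_conn_imp_chordless_path:
  assumes "avoid_conn (dominates G) w x y" "x \<in> verts G" "wf_digraph G"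
  shows "\<exists>p. path_between G x p y \<and> chordless G p \<and> avoids G p w"
proof -
  define r where "r = (\<lambda>a b. a \<rightarrow>\<^bsub>G\<^esub> b \<and> \<not> w \<rightarrow>\<^bsub>G\<^esub> b)"
  have wx: "\<not> w \<rightarrow>\<^bsub>G\<^esub> x" and r: "r\<^sup>*\<^sup>* x y" using assms(1) by (auto simp: avoid_conn_def r_def)
  define n where "n = (LEAST n. (r ^^ n) x y)"
  have "(r ^^ n) x y" unfolding n_def using r by (metis LeastI rtranclp_power)
  then obtain f where f: "f 0 = x" "f n = y" "\<And>i. i < n \<Longrightarrow> r (f i) (f (Suc i))"
    by (auto simp: relpowp_fun_conv)
  have least: "n \<le> m" if "(r ^^ m) x y" for m unfolding n_def using that by (rule Least_le)
  have pre: "(r ^^ i) x (f i)" if "i \<le> n" for i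
    using that f by (auto simp: relpowp_fun_conv)
  have suf: "(r ^^ (n - j)) (f j) y" if "j \<le> n" for j
    unfolding relpowp_fun_conv using that f by (intro exI[of _ "\<lambda>i. f (j + i)"]) auto
  \<comment> \<open>\<open>k = 0\<close> will give distinctness, \<open>k = 1\<close> the absence of
    chords.\<close>
  have no_shortcut: "\<not> (r ^^ k) (f i) (f j)" if "i + k < j" "j \<le> n" for i j k
  proof
    assume "(r ^^ k) (f i) (f j)"
    then have "(r ^^ (i + k + (n - j))) x y"
      using pre[of i] suf[of j] that unfolding relpowp_add by auto
    then show False using least that by fastforce
  qed
  define p where "p = map f [0..<Suc n]"
  have nth: "p ! i = f i" if "i \<le> n" for i
    unfolding p_def using that by (simp add: nth_map_upt del: upt_Suc)
  have len: "length p = Suc n" by (simp add: p_def)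
  have inj: "f i \<noteq> f j" if "i < j" "j \<le> n" for i j
    using no_shortcut[of i 0 j] that by auto
  have adj: "f i \<rightarrow>\<^bsub>G\<^esub> f (Suc i)" if "i < n" for i using f(3)[OF that] by (simp add: r_def)
  have fw: "\<not> w \<rightarrow>\<^bsub>G\<^esub> f i" if "i \<le> n" for i
    using that f wx by (cases i) (auto simp: r_def Suc_le_eq)
  have fV: "f i \<in> verts G" if "i \<le> n" for i
    using that f(1) assms(2) adj wf_digraph.adj_in_verts(2)[OF assms(3)]
    by (cases i) (auto simp: Suc_le_eq)
  have "distinct p"
    unfolding distinct_conv_nth using inj nth len by (metis less_Suc_eq_le linorder_neqE_nat)
  moreover have "set (vwalk_arcs p) \<subseteq> arcs_ends G"
    unfolding vwalk_arcs_conv_nth using nth len adj by auto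
  moreover have "set p \<subseteq> verts G" using fV by (auto simp: p_def simp del: upt_Suc)
  ultimately have "vpath p G" using len by (auto simp: vpath_def vwalk_def)
  moreover have "hd p = x" "last p = y" using f len nth
    by (auto simp: hd_conv_nth last_conv_nth simp flip: length_greater_0_conv)
  moreover have "chordless G p"
    unfolding chordless_def
  proof (intro allI impI notI)
    fix i j assume ij: "Suc i < j \<and> j < length p" and "p ! i \<rightarrow>\<^bsub>G\<^esub> p ! j"
    then have "f i \<rightarrow>\<^bsub>G\<^esub> f j" "j \<le> n" using nth len by auto
    then have "(r ^^ 1) (f i) (f j)" using fw by (auto simp: r_def)
    then show False using no_shortcut[of i 1 j] ij \<open>j \<le> n\<close> by auto
  qed
  moreover have "avoids G p w" using fw by (auto simp: avoids_def p_def simp del: upt_Suc)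
  ultimately show ?thesis unfolding path_between_def by blast
qed

section \<open>Betweenness, asteroidal triples and bad claws\<close>

lemma domination_betweenness_conv:
  assumes "wf_digraph G"
  shows "(x, y, z) \<in> domination_betweenness G \<longleftrightarrow> {x, y, z} \<subseteq> verts G \<and> distinct [x, y, z] \<and>
    avoid_conn (dominates G) z x y \<and> avoid_conn (dominates G) x y z"
  using assms path_avoids_imp_avoid_conn[of G] avoid_conn_imp_chordless_path[of G]
  unfolding domination_betweenness_def by auto

text \<open>Betweenness supplies two of the three connections of an asteroidal triple, so the third
  must fail.\<close>

lemma at_free_betweenness:
  assumes "graph G" "at_free G" and betw: "(x, y, z) \<in> domination_betweenness G"
  shows "\<not> avoid_conn (dominates G) y x z"
proof
  interpret graph G by fact
  let ?E = "dominates G"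
  assume yxz: "avoid_conn ?E y x z"
  have V: "{x, y, z} \<subseteq> verts G" "distinct [x, y, z]"
    and zxy: "avoid_conn ?E z x y" and xyz: "avoid_conn ?E x y z"
    using betw unfolding domination_betweenness_conv[OF wf_digraph_axioms] by blast+
  have sym: "?E a b \<Longrightarrow> ?E b a" for a b using sym_arcs by (auto simp: symmetric_def sym_def)
  have irrefl: "\<not> ?E a a" for a using no_loops by (auto simp: arcs_ends_conv)
  note conn = yxz zxy xyz
  have "symp ?E" using sym by (rule sympI)
  note conns = conn conn[THEN avoid_conn_sym[OF this]]
  have "\<exists>p. path_between G u p v \<and> avoids G p w"
    if "u \<in> {x, y, z}" "v \<in> {x, y, z}" "w \<in> {x, y, z}" "distinct [u, v, w]" for u v w
  proof -
    have "avoid_conn ?E w u v" using that conns by auto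
    then show ?thesis
      using avoid_conn_imp_chordless_path[OF _ _ wf_digraph_axioms] that V by blast
  qed
  moreover have "independent_set G {x, y, z}"
    unfolding independent_set_def using V conns[THEN avoid_conn_nonadj_left] irrefl by blast
  moreover have "card {x, y, z} = 3" using V by auto
  ultimately have "asteroidal_triple G {x, y, z}" unfolding asteroidal_triple_def by blast
  then show False using assms(2) unfolding at_free_def by blast
qed

text \<open>Betweenness already makes the three prongs pairwise non-adjacent.\<close>

lemma betweenness_bad_claw:
  assumes "graph G" "(a, z, b) \<in> domination_betweenness G"
    and "c \<rightarrow>\<^bsub>G\<^esub> a" "c \<rightarrow>\<^bsub>G\<^esub> b" "c \<rightarrow>\<^bsub>G\<^esub> z"
  shows "bad_claw G c a b z"
proof -
  interpret graph G by fact
  let ?E = "dominates G"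
  have V: "{a, z, b} \<subseteq> verts G" "distinct [a, z, b]"
    and conn: "avoid_conn ?E b a z" "avoid_conn ?E a z b"
    using assms(2) unfolding domination_betweenness_conv[OF wf_digraph_axioms] by blast+
  have sym: "?E a b \<Longrightarrow> ?E b a" for a b using sym_arcs by (auto simp: symmetric_def sym_def)
  have irrefl: "\<not> ?E a a" for a using no_loops by (auto simp: arcs_ends_conv)
  have "independent_set G {a, b, z}"
    unfolding independent_set_def
    using V conn[THEN avoid_conn_nonadj_left] conn[THEN avoid_conn_nonadj_right] irrefl sym by blast
  moreover have "c \<in> verts G" using assms(3) adj_in_verts by blast
  ultimately show ?thesis
    unfolding bad_claw_def induces_claw_def using assms V irrefl by auto
qed

section \<open>The two properties of LBFS orders\<close>

theorem theorem6:
  fixes G :: "('a,'b) pre_digraph" and s :: 'a and \<tau> :: "'a list"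
  assumes "graph G"
    and "connected G"
    and "at_free G"
    and "\<nexists>c a b z. bad_claw G c a b z"
    and "admissible G s"
    and "lbfs_order G s \<tau>"
  shows "at_free_order G \<tau> \<and> monotone_dominating_pair_order G \<tau>"
proof -
  interpret graph G by fact
  have sV: "s \<in> verts G" using assms(5) by (simp add: admissible_def)
  have ord: "vertex_ordering G \<tau>" using assms(6) by (intro lbfs_order_vertex_ordering) auto
  then have dist: "distinct \<tau>" and set: "set \<tau> = verts G" by (auto simp: vertex_ordering_def)
  obtain l where state: "lbfs_state G s l \<tau>" using assms(6) by (auto simp: lbfs_order_def)
  have ne: "\<tau> \<noteq> []" using sV set by auto
  have hd: "\<tau> ! 0 = s" using lbfs_state_hd[OF sV state ne] ne by (simp add: hd_conv_nth)
  define rk where "rk = the_inv_into {..<length \<tau>} ((!) \<tau>)"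
  have inj: "inj_on ((!) \<tau>) {..<length \<tau>}" using dist by (simp add: inj_on_nth)
  have rk_nth: "rk (\<tau> ! i) = i" if "i < length \<tau>" for i
    unfolding rk_def using that the_inv_into_f_f[OF inj, of i] by simp
  have nth_rk: "rk v < length \<tau>" "\<tau> ! rk v = v" if "v \<in> verts G" for v
    using that rk_nth set by (metis in_set_conv_nth)+
  let ?E = "dominates G"
  interpret L: lbfs_ranked_graph "verts G" ?E s rk
  proof
    show "b \<rightarrow>\<^bsub>G\<^esub> a" if "a \<rightarrow>\<^bsub>G\<^esub> b" for a b
      using that sym_arcs by (auto simp: symmetric_def sym_def)
    show "\<not> a \<rightarrow>\<^bsub>G\<^esub> a" for a using no_loops by (auto simp: arcs_ends_conv)
    show "a \<in> verts G" if "a \<rightarrow>\<^bsub>G\<^esub> b" for a b using that adj_in_verts by blast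
    show "inj_on rk (verts G)" using nth_rk by (metis inj_onI)
    show "s \<in> verts G" by fact
    show "rk s \<le> rk v" for v using rk_nth[of 0] hd ne by simp
    show "?E\<^sup>*\<^sup>* s v" if "v \<in> verts G" for v
    proof -
      have "s \<rightarrow>\<^sup>*\<^bsub>G\<^esub> v"
        using symmetric_connected_imp_strongly_connected[OF sym_arcs assms(2)] that sV by blast
      then show ?thesis
      proof (induction rule: reachable_induct)
        case (step x y)
        then show ?case by (simp add: rtranclp.rtrancl_into_rtrancl)
      qed simp
    qed
    fix a b c
    assume *: "rk a < rk b" "rk b < rk c" "a \<rightarrow>\<^bsub>G\<^esub> c" "\<not> a \<rightarrow>\<^bsub>G\<^esub> b" "b \<in> verts G"
    then have V: "a \<in> verts G" "c \<in> verts G" using adj_in_verts by auto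
    have "c \<notin> set (take (Suc (rk b)) \<tau>)"
      using *(2) rk_nth nth_rk V by (auto simp: in_set_conv_nth)
    then obtain d where "d < rk a" "\<tau> ! d \<rightarrow>\<^bsub>G\<^esub> b" "\<not> \<tau> ! d \<rightarrow>\<^bsub>G\<^esub> c"
      using lbfs_state_four_point[OF state sV finite_verts *(1), of c] * V nth_rk by auto
    moreover have "rk (\<tau> ! d) = d" using calculation nth_rk(1)[OF V(1)] rk_nth by auto
    ultimately show "\<exists>d. rk d < rk a \<and> d \<rightarrow>\<^bsub>G\<^esub> b \<and> \<not> d \<rightarrow>\<^bsub>G\<^esub> c" by metis
  qed
  have betw: "L.betw x y z \<longleftrightarrow> (x, y, z) \<in> domination_betweenness G" for x y z
    unfolding L.betw_def domination_betweenness_conv[OF wf_digraph_axioms] by blast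
  have at: "\<not> L.conn y x z" if "L.betw x y z" for x y z
    using that at_free_betweenness[OF assms(1,3)] betw by blast
  have claw: False if "L.betw a z b" "c \<rightarrow>\<^bsub>G\<^esub> a" "c \<rightarrow>\<^bsub>G\<^esub> b" "c \<rightarrow>\<^bsub>G\<^esub> z" for c a b z
    using that betweenness_bad_claw[OF assms(1)] assms(4) betw by blast
  have adm: "\<not> L.betw a s b" for a b using assms(5) betw by (auto simp: admissible_def)
  have late: False if *: "L.betw x y z" "rk x < rk y" "rk z < rk y" for x y z
  proof -
    have "x \<in> verts G" "z \<in> verts G" "x \<noteq> z" using *(1) by (auto simp: L.betw_def)
    then consider "rk x < rk z" | "rk z < rk x" by (rule L.rk_cases)
    then show False
    proof cases
      case 1
      from L.no_late_betw[OF *(1) 1 *(3) at claw adm] show False .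
    next
      case 2
      from L.no_late_betw[OF L.betw_sym[OF *(1)] 2 *(2) at claw adm] show False .
    qed
  qed
  have prec: "precedes \<tau> u v" if "rk u < rk v" "u \<in> verts G" "v \<in> verts G" for u v
    unfolding precedes_def using that nth_rk by metis
  have "at_free_order G \<tau>"
    unfolding at_free_order_def
  proof (intro conjI ord, clarify)
    fix x y z assume *: "(x, y, z) \<in> domination_betweenness G" "\<not> precedes \<tau> y z"
    then have b: "L.betw x y z" using betw by blast
    then have V: "x \<in> verts G" "y \<in> verts G" "z \<in> verts G" "y \<noteq> x" "y \<noteq> z"
      by (auto simp: L.betw_def)
    then have "rk z < rk y" using *(2) prec L.rk_cases by metis
    then have "rk y < rk x" using late[OF b] V L.rk_cases by metis
    then show "precedes \<tau> y x" using prec V by blast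
  qed
  moreover have "monotone_dominating_pair_order G \<tau>"
    unfolding monotone_dominating_pair_order_def
  proof (intro conjI ord allI impI)
    fix i assume i: "i < length \<tau>"
    let ?S = "set (take (Suc i) \<tau>)"
    let ?H = "G \<restriction> ?S"
    have S: "?S \<subseteq> verts G" using set set_take_subset by fast
    have iS: "\<tau> ! i \<in> ?S" "\<tau> ! 0 \<in> ?S" using i by (auto simp: in_set_conv_nth)
    have "dominating_set ?H (set p)" if "path_between ?H (\<tau> ! 0) p (\<tau> ! i)" for p
    proof -
      have p: "set p \<subseteq> ?S" "set (vwalk_arcs p) \<subseteq> arcs_ends ?H" "p \<noteq> []" "distinct p"
          "hd p = s" "last p = \<tau> ! i"
        using that hd by (auto simp: path_between_def vpath_def vwalk_def)
      have "arcs_ends ?H \<subseteq> arcs_ends G" by (auto dest: dominates_induce_subgraphD)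
      then have pG: "path_between G s p (\<tau> ! i)"
        using p S by (auto simp: path_between_def vpath_def vwalk_def)
      have "\<exists>u \<in> set p. u \<rightarrow>\<^bsub>?H\<^esub> v" if v: "v \<in> ?S" "v \<notin> set p" for v
      proof (rule ccontr)
        assume neg: "\<not> ?thesis"
        \<comment> \<open>Both ends lie in the prefix, so an edge of \<open>G\<close> would survive
          in the induced subgraph and \<open>p\<close> would dominate \<open>v\<close>.\<close>
        have nG: "\<not> v \<rightarrow>\<^bsub>G\<^esub> u" if "u \<in> set p" for u
        proof
          assume "v \<rightarrow>\<^bsub>G\<^esub> u"
          then have "u \<rightarrow>\<^bsub>G\<^esub> v" by (rule L.sym)
          then have "u \<rightarrow>\<^bsub>?H\<^esub> v" using v(1) p(1) that by (auto simp: arcs_ends_conv)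
          then show False using neg that by blast
        qed
        then have conn: "L.conn v s (\<tau> ! i)"
          by (intro path_avoids_imp_avoid_conn[OF pG]) (auto simp: avoids_def)
        have "v \<noteq> s" "v \<noteq> \<tau> ! i" using v(2) p(3,5,6) hd_in_set last_in_set by metis+
        moreover have "rk v < Suc i" using v(1) i rk_nth by (auto simp: in_set_conv_nth)
        moreover have V: "\<tau> ! i \<in> verts G" "v \<in> verts G" using iS v(1) S by auto
        ultimately have "rk v < rk (\<tau> ! i)"
          using rk_nth[OF i] nth_rk(2)[of v] by (cases "rk v = i") auto
        from L.later_not_conn_root[OF V this conn \<open>v \<noteq> s\<close> late adm] show False .
      qed
      then show ?thesis unfolding dominating_set_def using p(1) by auto
    qed
    then show "dominating_pair ?H (\<tau> ! 0) (\<tau> ! i)"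
      unfolding dominating_pair_def using iS by simp
  qed
  ultimately show ?thesis by blast
qed

end
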